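(* Let $S$ be a finite non-commutative completely simple semigroup. If the commuting graph $\mathcal{G}(S)$ contains at least one cycle, then the girth of $\mathcal{G}(S)$ is equal to $3$.
   Context: The center of a semigroup $S$ is $Z(S)=\{x\in S: xy=yx\text{ for all }y\in S\}$. For a finite non-commutative semigroup $S$, the commuting graph $\mathcal{G}(S)$ is the simple graph with vertex set $S\setminus Z(S)$ in which two distinct vertices $x,y$ are adjacent if and only if $xy=yx$. The girth of a graph containing cycles is the length of a shortest cycle. A semigroup without a zero is completely simple if it contains no proper ideals and it contains a minimal idempotent (minimal for the partial order on idempotents given by $e\leqslant f$ if and only if $ef=fe=e$). *)

theory Defs
  imports "Graph_Theory.Pair_Digraph"
begin

definition is_semigroup :: "'a set \<Rightarrow> ('a \<Rightarrow> 'a \<Rightarrow> 'a) \<Rightarrow> bool" where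
  "is_semigroup S f \<longleftrightarrow>
     (\<forall>x\<in>S. \<forall>y\<in>S. f x y \<in> S) \<and>
     (\<forall>x\<in>S. \<forall>y\<in>S. \<forall>z\<in>S. f (f x y) z = f x (f y z))"

definition is_commutative :: "'a set \<Rightarrow> ('a \<Rightarrow> 'a \<Rightarrow> 'a) \<Rightarrow> bool" where
  "is_commutative S f \<longleftrightarrow> (\<forall>x\<in>S. \<forall>y\<in>S. f x y = f y x)"

definition center :: "'a set \<Rightarrow> ('a \<Rightarrow> 'a \<Rightarrow> 'a) \<Rightarrow> 'a set" where
  "center S f = {x\<in>S. \<forall>y\<in>S. f x y = f y x}"

definition has_zero :: "'a set \<Rightarrow> ('a \<Rightarrow> 'a \<Rightarrow> 'a) \<Rightarrow> bool" where
  "has_zero S f \<longleftrightarrow> (\<exists>z\<in>S. \<forall>x\<in>S. f z x = z \<and> f x z = z)"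

text \<open>Ideals are two-sided and, as usual in semigroup theory, nonempty.\<close>

definition is_ideal :: "'a set \<Rightarrow> ('a \<Rightarrow> 'a \<Rightarrow> 'a) \<Rightarrow> 'a set \<Rightarrow> bool" where
  "is_ideal S f I \<longleftrightarrow>
     I \<noteq> {} \<and> I \<subseteq> S \<and> (\<forall>a\<in>I. \<forall>x\<in>S. f a x \<in> I \<and> f x a \<in> I)"

definition idempotents :: "'a set \<Rightarrow> ('a \<Rightarrow> 'a \<Rightarrow> 'a) \<Rightarrow> 'a set" where
  "idempotents S f = {e\<in>S. f e e = e}"

definition idem_le :: "('a \<Rightarrow> 'a \<Rightarrow> 'a) \<Rightarrow> 'a \<Rightarrow> 'a \<Rightarrow> bool" where
  "idem_le f e e' \<longleftrightarrow> f e e' = e \<and> f e' e = e"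

definition is_minimal_idempotent :: "'a set \<Rightarrow> ('a \<Rightarrow> 'a \<Rightarrow> 'a) \<Rightarrow> 'a \<Rightarrow> bool" where
  "is_minimal_idempotent S f e \<longleftrightarrow>
     e \<in> idempotents S f \<and> (\<forall>e'\<in>idempotents S f. idem_le f e' e \<longrightarrow> e' = e)"

definition completely_simple :: "'a set \<Rightarrow> ('a \<Rightarrow> 'a \<Rightarrow> 'a) \<Rightarrow> bool" where
  "completely_simple S f \<longleftrightarrow>
     is_semigroup S f \<and> \<not> has_zero S f \<and>
     \<not> (\<exists>I. is_ideal S f I \<and> I \<noteq> S) \<and>
     (\<exists>e. is_minimal_idempotent S f e)"

text \<open>A simple graph is represented, as in the locale \<^locale>\<open>pair_graph\<close>, by a loop-free
  symmetric arc relation: the edge between \<open>x\<close> and \<open>y\<close> is the pair of arcs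
  \<open>(x, y)\<close>, \<open>(y, x)\<close>.\<close>

definition commuting_graph :: "'a set \<Rightarrow> ('a \<Rightarrow> 'a \<Rightarrow> 'a) \<Rightarrow> 'a pair_pre_digraph" where
  "commuting_graph S f =
     \<lparr> pverts = S - center S f,
       parcs = {(x, y). x \<in> S - center S f \<and> y \<in> S - center S f \<and> x \<noteq> y \<and> f x y = f y x} \<rparr>"

lemma pair_graph_commuting_graph:
  assumes "finite S"
  shows "pair_graph (commuting_graph S f)"
proof
  show "finite (parcs (commuting_graph S f))"
    by (rule finite_subset[of _ "S \<times> S"]) (auto simp: commuting_graph_def assms)
qed (auto simp: commuting_graph_def assms symmetric_def intro!: symI)

text \<open>The directed notion \<^const>\<open>pre_digraph.cycle\<close> admits \<open>x, y, x\<close>, which traverses a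
  single undirected edge back and forth; a cycle of a simple graph has length at least \<open>3\<close>.\<close>

definition is_graph_cycle :: "'a pair_pre_digraph \<Rightarrow> ('a \<times> 'a) list \<Rightarrow> bool" where
  "is_graph_cycle G p \<longleftrightarrow> pre_digraph.cycle (with_proj G) p \<and> 3 \<le> length p"

text \<open>The girth is meaningful only if \<open>G\<close> contains a cycle.\<close>

definition girth :: "'a pair_pre_digraph \<Rightarrow> nat" where
  "girth G = (LEAST n. \<exists>p. is_graph_cycle G p \<and> length p = n)"

end

theory Submission
  imports Defs
begin

text \<open>
  A finite semigroup \<open>S\<close> without proper ideals satisfies \<open>x \<in> x a S\<close> for all \<open>x, a \<in> S\<close>: write
  \<open>x = u x (a v)\<close> by simplicity and iterate this equation until the power of \<open>u\<close> becomes
  idempotent, so that it can be absorbed (\<open>right_stability\<close>). This makes an element \<open>x\<close> behave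
  like a member of a group towards everything that commutes with it: an idempotent is an identity
  for all elements that it commutes with (\<open>commuting_idempotent_identity\<close>), and \<open>x\<close> may be
  cancelled from equations between elements that it commutes with (\<open>commuting_cancel\<close>), because
  some power of \<open>x\<close> is idempotent.
  The graph is then treated in the same way whether or not \<open>S\<close> is a group.

  Now let \<open>x\<close> be a vertex of the commuting graph that is not idempotent and has two different
  neighbours \<open>y\<close> and \<open>y'\<close>. If \<open>x y\<close> commutes with \<open>y'\<close>, then cancelling \<open>x\<close> shows that \<open>y\<close> and
  \<open>y'\<close> commute, so \<open>x, y, y'\<close> is a triangle. Otherwise \<open>x y\<close> is not central and differs from \<open>x\<close>,
  which does commute with \<open>y'\<close>; it differs from \<open>y\<close> as well, since \<open>x y = y\<close> would make \<open>x\<close>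
  idempotent. Then \<open>x, y, x y\<close> is a triangle. A cycle provides a suitable vertex: two
  commuting idempotents are equal, so one of any two consecutive vertices of the cycle
  is not idempotent.
\<close>

section \<open>Powers in a finite semigroup\<close>

locale finite_semigroup =
  fixes S :: "'a set" and mult :: "'a \<Rightarrow> 'a \<Rightarrow> 'a" (infixl "\<cdot>" 70)
  assumes finite_carrier: "finite S"
    and semigroup: "is_semigroup S (\<cdot>)"
begin

lemma closed [simp]: "x \<in> S \<Longrightarrow> y \<in> S \<Longrightarrow> x \<cdot> y \<in> S"
  using semigroup by (simp add: is_semigroup_def)

lemma assoc: "x \<in> S \<Longrightarrow> y \<in> S \<Longrightarrow> z \<in> S \<Longrightarrow> x \<cdot> y \<cdot> z = x \<cdot> (y \<cdot> z)"
  using semigroup by (simp add: is_semigroup_def)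

text \<open>There is no neutral element to start from, so exponents are shifted by one:
  \<open>pow_Suc x n\<close> is \<open>x\<close> to the power \<open>n + 1\<close>.\<close>

primrec pow_Suc :: "'a \<Rightarrow> nat \<Rightarrow> 'a" where
  "pow_Suc x 0 = x"
| "pow_Suc x (Suc n) = x \<cdot> pow_Suc x n"

lemma pow_Suc_closed [simp]: "x \<in> S \<Longrightarrow> pow_Suc x n \<in> S"
  by (induction n) auto

lemma pow_Suc_add:
  "x \<in> S \<Longrightarrow> pow_Suc x m \<cdot> pow_Suc x n = pow_Suc x (Suc (m + n))"
  by (induction m) (auto simp: assoc)

lemma pow_Suc_commute:
  assumes "x \<in> S" "y \<in> S" "x \<cdot> y = y \<cdot> x"
  shows "pow_Suc x n \<cdot> y = y \<cdot> pow_Suc x n"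
proof (induction n)
  case (Suc n)
  have "x \<cdot> pow_Suc x n \<cdot> y = x \<cdot> (y \<cdot> pow_Suc x n)"
    using assms Suc by (simp add: assoc)
  also have "\<dots> = y \<cdot> x \<cdot> pow_Suc x n"
    using assms by (simp flip: assoc)
  finally show ?case
    using assms by (simp add: assoc)
qed (simp add: assms)

text \<open>By the pigeonhole principle the powers of \<open>x\<close> are eventually periodic; an exponent that is
  a multiple of the period and lies beyond the preperiod belongs to an idempotent.\<close>

lemma ex_idempotent_power:
  assumes x: "x \<in> S"
  shows "\<exists>n. pow_Suc x n \<cdot> pow_Suc x n = pow_Suc x n"
proof -
  have "\<not> inj (pow_Suc x)"
    using x finite_carrier finite_subset[of "range (pow_Suc x)" S]
    by (auto dest: finite_imageD simp: image_subset_iff)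
  then obtain i j where "pow_Suc x i = pow_Suc x j" "i < j"
    unfolding inj_def by (metis nat_neq_iff)
  then obtain d where ij: "pow_Suc x (i + Suc d) = pow_Suc x i"
    by (metis less_imp_Suc_add add_Suc_right)
  have shift: "pow_Suc x (i + t + Suc d) = pow_Suc x (i + t)" for t
  proof (induction t)
    case (Suc t)
    then show ?case by (metis add_Suc add_Suc_right pow_Suc.simps(2))
  qed (use ij in simp)
  have period: "pow_Suc x (i + t + k * Suc d) = pow_Suc x (i + t)" for t k
  proof (induction k)
    case (Suc k)
    have "i + t + Suc k * Suc d = i + (t + k * Suc d) + Suc d" by simp
    then show ?case using shift[of "t + k * Suc d"] Suc by (simp only: add.assoc)
  qed simp
  \<comment> \<open>The exponent \<open>n + 1\<close> is the multiple \<open>(i + 1) (d + 1)\<close> of the period \<open>d + 1\<close>.\<close>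
  define n where "n = i + d * Suc i"
  have "Suc (n + n) = i + d * Suc i + Suc i * Suc d"
    by (simp add: n_def algebra_simps)
  then have "pow_Suc x (Suc (n + n)) = pow_Suc x n"
    unfolding n_def using period by metis
  then show ?thesis
    using pow_Suc_add[OF x] by metis
qed

end

section \<open>Finite semigroups without proper ideals\<close>

locale finite_simple_semigroup = finite_semigroup +
  assumes simple: "is_ideal S (\<cdot>) I \<Longrightarrow> I = S"
begin

text \<open>The set \<open>S a S\<close> is an ideal, hence all of \<open>S\<close>.\<close>

lemma ex_two_sided_factorisation:
  assumes "x \<in> S" "a \<in> S"
  shows "\<exists>u\<in>S. \<exists>v\<in>S. x = u \<cdot> a \<cdot> v"
proof -
  let ?I = "{u \<cdot> a \<cdot> v | u v. u \<in> S \<and> v \<in> S}"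
  have "is_ideal S (\<cdot>) ?I"
    unfolding is_ideal_def
  proof (intro conjI ballI)
    show "?I \<noteq> {}" "?I \<subseteq> S" using assms by auto
  next
    fix b y assume "b \<in> ?I" and y: "y \<in> S"
    then obtain u v where b: "b = u \<cdot> a \<cdot> v" "u \<in> S" "v \<in> S" by auto
    then have "b \<cdot> y = u \<cdot> a \<cdot> (v \<cdot> y)" "y \<cdot> b = y \<cdot> u \<cdot> a \<cdot> v"
      using y assms by (auto simp: assoc)
    then show "b \<cdot> y \<in> ?I" "y \<cdot> b \<in> ?I"
      using b y by (metis (mono_tags, lifting) closed mem_Collect_eq)+
  qed
  then have "?I = S" by (rule simple)
  then show ?thesis using assms by blast
qed

lemma iterate_two_sided_factorisation:
  assumes "x \<in> S" "u \<in> S" "w \<in> S" "x = u \<cdot> x \<cdot> w"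
  shows "x = pow_Suc u n \<cdot> x \<cdot> pow_Suc w n"
proof (induction n)
  case (Suc n)
  have "x = u \<cdot> (pow_Suc u n \<cdot> x \<cdot> pow_Suc w n) \<cdot> w"
    using assms(4) Suc by simp
  also have "\<dots> = u \<cdot> pow_Suc u n \<cdot> x \<cdot> (w \<cdot> pow_Suc w n)"
    using assms(1-3) pow_Suc_commute[of w w n] by (simp add: assoc)
  finally show ?case by simp
qed (use assms(4) in simp)

text \<open>If \<open>x = u x (a v)\<close>, then \<open>x\<close> absorbs the idempotent power of \<open>u\<close> on the left, and what is
  left of the iterated equation is \<open>x = x (a v) \<cdots> (a v)\<close>.\<close>

lemma right_stability:
  assumes x: "x \<in> S" and a: "a \<in> S"
  shows "\<exists>s\<in>S. x = x \<cdot> a \<cdot> s"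
proof -
  obtain u v where uv: "u \<in> S" "v \<in> S" "x = u \<cdot> (x \<cdot> a) \<cdot> v"
    using ex_two_sided_factorisation[of x "x \<cdot> a"] x a by auto
  then have "x = u \<cdot> x \<cdot> (a \<cdot> v)"
    using x a by (simp add: assoc)
  then have iter: "x = pow_Suc u n \<cdot> x \<cdot> pow_Suc (a \<cdot> v) n" for n
    using iterate_two_sided_factorisation[of x u "a \<cdot> v"] uv x a by simp
  obtain n where idem: "pow_Suc u n \<cdot> pow_Suc u n = pow_Suc u n"
    using ex_idempotent_power uv(1) by blast
  have "pow_Suc u n \<cdot> x = pow_Suc u n \<cdot> (pow_Suc u n \<cdot> x \<cdot> pow_Suc (a \<cdot> v) n)"
    using iter[of n] by simp
  also have "\<dots> = pow_Suc u n \<cdot> pow_Suc u n \<cdot> x \<cdot> pow_Suc (a \<cdot> v) n"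
    using uv(1,2) x a by (simp add: assoc)
  also have "\<dots> = x"
    using idem iter[of n] by simp
  finally have "x = x \<cdot> pow_Suc (a \<cdot> v) n"
    using iter[of n] by simp
  also have "\<dots> = x \<cdot> pow_Suc (a \<cdot> v) n \<cdot> pow_Suc (a \<cdot> v) n"
    using calculation by simp
  also have "\<dots> = x \<cdot> pow_Suc (a \<cdot> v) (Suc (n + n))"
    using uv(2) x a by (simp add: assoc pow_Suc_add)
  also have "\<dots> = x \<cdot> a \<cdot> (v \<cdot> pow_Suc (a \<cdot> v) (n + n))"
    using uv(2) x a by (simp add: assoc)
  finally show ?thesis
    using uv(2) a by (meson closed pow_Suc_closed)
qed

section \<open>Commuting elements\<close>

text \<open>Stability gives \<open>y = y e s = e (y s)\<close>, and left multiplication by \<open>e\<close> fixes every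
  element of \<open>e S\<close>.\<close>

lemma commuting_idempotent_identity:
  assumes e: "e \<in> S" "e \<cdot> e = e" and y: "y \<in> S" and comm: "e \<cdot> y = y \<cdot> e"
  shows "e \<cdot> y = y"
proof -
  obtain s where s: "s \<in> S" "y = y \<cdot> e \<cdot> s"
    using right_stability[OF y e(1)] by auto
  then have ys: "y = e \<cdot> (y \<cdot> s)"
    using comm e(1) y by (metis assoc)
  then have "e \<cdot> y = e \<cdot> e \<cdot> (y \<cdot> s)"
    using e(1) y s(1) by (metis assoc closed)
  then show ?thesis using e(2) ys by simp
qed

lemma commuting_idempotents_eq:
  assumes "e \<in> S" "e \<cdot> e = e" "g \<in> S" "g \<cdot> g = g" "e \<cdot> g = g \<cdot> e"
  shows "e = g"
proof -
  have "e \<cdot> g = g"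
    by (rule commuting_idempotent_identity) fact+
  moreover have "g \<cdot> e = e"
    by (rule commuting_idempotent_identity) (fact | rule sym, fact)+
  ultimately show ?thesis using assms(5) by simp
qed

text \<open>The idempotent power of \<open>x\<close> commutes with \<open>b\<close> and \<open>c\<close>, hence is an identity for them; and
  multiplying \<open>x b = x c\<close> by the remaining factors \<open>x\<close> produces that power on both sides.\<close>

lemma commuting_cancel:
  assumes x: "x \<in> S" and b: "b \<in> S" "x \<cdot> b = b \<cdot> x" and c: "c \<in> S" "x \<cdot> c = c \<cdot> x"
    and eq: "x \<cdot> b = x \<cdot> c"
  shows "b = c"
proof -
  obtain n where n: "pow_Suc x n \<cdot> pow_Suc x n = pow_Suc x n"
    using ex_idempotent_power x by blast
  have id: "pow_Suc x n \<cdot> z = z" if "z \<in> S" "x \<cdot> z = z \<cdot> x" for z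
    by (rule commuting_idempotent_identity[OF _ n that(1) pow_Suc_commute[OF x that]]) (simp add: x)
  have "pow_Suc x n \<cdot> b = pow_Suc x n \<cdot> c"
  proof (cases n)
    case (Suc m)
    have "pow_Suc x n = pow_Suc x m \<cdot> x"
      using Suc x pow_Suc_commute[of x x m] by simp
    then show ?thesis using eq x b(1) c(1) by (simp add: assoc)
  qed (simp add: eq)
  then show ?thesis using id[OF b] id[OF c] by simp
qed

lemma product_commutes:
  assumes "x \<in> S" "y \<in> S" "z \<in> S" "x \<cdot> y = y \<cdot> x" "x \<cdot> z = z \<cdot> x"
  shows "x \<cdot> (y \<cdot> z) = y \<cdot> z \<cdot> x"
  using assms by (metis assoc)

text \<open>The condition rewrites to \<open>x (y z) = x (z y)\<close>, where \<open>x\<close> commutes with both products.\<close>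

lemma commute_if_product_commutes:
  assumes x: "x \<in> S" and y: "y \<in> S" "x \<cdot> y = y \<cdot> x" and z: "z \<in> S" "x \<cdot> z = z \<cdot> x"
    and xyz: "x \<cdot> y \<cdot> z = z \<cdot> (x \<cdot> y)"
  shows "y \<cdot> z = z \<cdot> y"
proof (rule commuting_cancel[OF x])
  show "x \<cdot> (y \<cdot> z) = x \<cdot> (z \<cdot> y)"
    using x y(1) z xyz by (metis assoc)
  show "x \<cdot> (y \<cdot> z) = y \<cdot> z \<cdot> x" by (rule product_commutes) fact+
  show "x \<cdot> (z \<cdot> y) = z \<cdot> y \<cdot> x" by (rule product_commutes) fact+
qed (simp_all add: y(1) z(1))

section \<open>Triangles in the commuting graph\<close>

text \<open>The third corner is \<open>z\<close> if \<open>x y\<close> commutes with \<open>z\<close>. If it does not, then \<open>z\<close> witnesses that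
  \<open>x y\<close> is a vertex different from \<open>x\<close>, and \<open>x y\<close> is the third corner.\<close>

lemma ex_triangle_at_non_idempotent:
  fixes A
  defines "A \<equiv> parcs (commuting_graph S (\<cdot>))"
  assumes xy: "(x, y) \<in> A" and xz: "(x, z) \<in> A" and "y \<noteq> z" and non_idem: "x \<cdot> x \<noteq> x"
  shows "\<exists>w. (x, y) \<in> A \<and> (y, w) \<in> A \<and> (w, x) \<in> A"
proof (cases "x \<cdot> y \<cdot> z = z \<cdot> (x \<cdot> y)")
  case True
  then have "y \<cdot> z = z \<cdot> y"
    using commute_if_product_commutes[of x y z] xy xz
    by (simp add: A_def commuting_graph_def center_def)
  then have "(y, z) \<in> A" "(z, x) \<in> A"
    using xy xz \<open>y \<noteq> z\<close> by (auto simp: A_def commuting_graph_def)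
  then show ?thesis using xy by blast
next
  case False
  have in_S: "x \<in> S" "y \<in> S" "z \<in> S" and comm: "x \<cdot> y = y \<cdot> x" "x \<cdot> z = z \<cdot> x"
    using xy xz by (auto simp: A_def commuting_graph_def)
  have "x \<cdot> y \<in> S - center S (\<cdot>)"
    using False in_S by (auto simp: center_def)
  moreover have "x \<cdot> y \<noteq> x"
    using False comm by auto
  moreover have "x \<cdot> y \<noteq> y"
  proof
    assume "x \<cdot> y = y"
    \<comment> \<open>Cancelling \<open>y\<close> from \<open>y (x x) = y x\<close> would make \<open>x\<close> idempotent.\<close>
    then have "y \<cdot> (x \<cdot> x) = y \<cdot> x"
      using in_S comm by (metis assoc)
    then have "x \<cdot> x = x"
      using commuting_cancel[OF in_S(2) _ product_commutes _ comm(1)[symmetric]] in_S comm(1)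
      by simp
    then show False using non_idem by simp
  qed
  moreover have "x \<cdot> y \<cdot> x = x \<cdot> (x \<cdot> y)" "y \<cdot> (x \<cdot> y) = x \<cdot> y \<cdot> y"
    using in_S comm by (metis assoc)+
  ultimately have "(y, x \<cdot> y) \<in> A" "(x \<cdot> y, x) \<in> A"
    using xy by (auto simp: A_def commuting_graph_def)
  then show ?thesis using xy by blast
qed

end

section \<open>Cycles and girth\<close>

lemma pcas_ends_in_verts: "pcas u p v \<Longrightarrow> {u, v} \<subseteq> set (pawalk_verts u p)"
  by (induction p arbitrary: u) auto

text \<open>Each of the adjacent vertices \<open>x\<close> and \<open>y\<close> has two different neighbours, so a triangle may be
  sought at whichever of them is not idempotent. The ends \<open>a\<close> and \<open>b\<close> coincide if the cycle has
  length three.\<close>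

lemma graph_cycle_obtains_path:
  assumes "is_graph_cycle G p"
  obtains a x y b where "(a, x) \<in> parcs G" "(x, y) \<in> parcs G" "(y, b) \<in> parcs G" "a \<noteq> y" "b \<noteq> x"
proof -
  obtain u where walk: "pre_digraph.awalk (with_proj G) u p u"
    and dist: "distinct (tl (pawalk_verts u p))" and len: "3 \<le> length p"
    using assms by (auto simp: is_graph_cycle_def pre_digraph.cycle_def awalk_verts_with_proj_eq)
  obtain e1 e2 e3 q where p: "p = e1 # e2 # e3 # q"
    using len by (auto simp: numeral_3_eq_3 Suc_le_length_iff)
  from walk p have arcs: "{e1, e2, e3} \<subseteq> parcs G" and cas: "pcas u p u"
    by (auto simp: pre_digraph.awalk_def cas_with_proj_eq)
  obtain x y b where e: "e1 = (u, x)" "e2 = (x, y)" "e3 = (y, b)" and q: "pcas b q u"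
    using cas p by (cases e1; cases e2; cases e3) auto
  \<comment> \<open>The start \<open>u\<close> reappears as the end of the walk \<open>q\<close>, whose vertices avoid \<open>x\<close> and \<open>y\<close>.\<close>
  have "u \<in> set (pawalk_verts b q)" "b \<in> set (pawalk_verts b q)"
    using pcas_ends_in_verts[OF q] by auto
  then have "u \<noteq> y" "b \<noteq> x"
    using dist p e by auto
  then show ?thesis using that arcs e by blast
qed

lemma girth_eq_3_if_triangle:
  assumes "pair_graph G" and arcs: "(x, y) \<in> parcs G" "(y, z) \<in> parcs G" "(z, x) \<in> parcs G"
  shows "girth G = 3"
  unfolding girth_def
proof (rule Least_equality)
  interpret pair_graph G by fact
  have "x \<noteq> y" "y \<noteq> z" "z \<noteq> x" "x \<in> pverts G"
    using arcs no_loops' in_arcsD1 by auto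
  then have "is_graph_cycle G [(x, y), (y, z), (z, x)]"
    using arcs by (auto simp: is_graph_cycle_def pre_digraph.cycle_def pre_digraph.awalk_def)
  then show "\<exists>p. is_graph_cycle G p \<and> length p = 3"
    by force
qed (auto simp: is_graph_cycle_def)

theorem theorem4p3:
  fixes S :: "'a set" and f :: "'a \<Rightarrow> 'a \<Rightarrow> 'a"
  assumes "finite S"
    and "completely_simple S f"
    and "\<not> is_commutative S f"
    and "\<exists>p. is_graph_cycle (commuting_graph S f) p"
  shows "girth (commuting_graph S f) = 3"
proof -
  let ?A = "parcs (commuting_graph S f)"
  interpret finite_simple_semigroup S f
    using assms(1,2) by unfold_locales (auto simp: completely_simple_def)
  obtain a x y b where path: "(a, x) \<in> ?A" "(x, y) \<in> ?A" "(y, b) \<in> ?A" "a \<noteq> y" "b \<noteq> x"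
    using assms(4) graph_cycle_obtains_path by metis
  have arc_sym: "(w, v) \<in> ?A" if "(v, w) \<in> ?A" for v w
    using that by (auto simp: commuting_graph_def)
  have "f x x \<noteq> x \<or> f y y \<noteq> y"
    using path(2) commuting_idempotents_eq[of x y] by (auto simp: commuting_graph_def)
  then have "\<exists>v w t. (v, w) \<in> ?A \<and> (w, t) \<in> ?A \<and> (t, v) \<in> ?A"
    using ex_triangle_at_non_idempotent[of x y a] ex_triangle_at_non_idempotent[of y x b] path arc_sym
    by metis
  then show ?thesis
    using girth_eq_3_if_triangle[OF pair_graph_commuting_graph[OF assms(1)]] by blast
qed

end
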